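(* Let $\varphi_H(z)=\cosh\sqrt z$ (i.e. the entire function $\sum_{n\ge0}z^n/(2n)!$) and $\varphi_L(z)=\sqrt{1+z}$ (principal branch) for $z\in\mathbb D$. Then $$R_{\mathcal S^*(\varphi_L)}(\mathcal S^*(\varphi_H))=\bigl(\operatorname{arcosh}\sqrt2\bigr)^2=\bigl(\operatorname{arsinh}1\bigr)^2.$$
   Context: Let $\mathbb D=\{z\in\mathbb C:|z|<1\}$ and let $\mathcal A$ be the class of functions $f$ analytic on $\mathbb D$ with $f(0)=0$ and $f'(0)=1$. For an analytic function $\varphi$ on $\mathbb D$ with $\varphi(0)=1$, the class $\mathcal S^*(\varphi)$ consists of all $f\in\mathcal A$ with $zf'(z)/f(z)\prec\varphi(z)$; that is, there is an analytic $\omega:\mathbb D\to\mathbb D$ with $\omega(0)=0$ such that $zf'(z)/f(z)=\varphi(\omega(z))$ on $\mathbb D$ (the quotient takes the value $1$ at $z=0$, and $f$ has no other zeros). For two such functions $\varphi_1,\varphi_2$, the sharp $\mathcal S^*(\varphi_2)$-radius of $\mathcal S^*(\varphi_1)$ is $$R_{\mathcal S^*(\varphi_2)}(\mathcal S^*(\varphi_1))=\sup\left\{r\in(0,1]: f_r(z)=\tfrac{f(rz)}{r}\text{ belongs to }\mathcal S^*(\varphi_2)\text{ for every } f\in\mathcal S^*(\varphi_1)\right\}.$$ *)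

theory Defs
  imports "HOL-Analysis.Analysis"
begin

abbreviation unit_disk :: "complex set" where
  "unit_disk \<equiv> ball 0 1"

definition class_A :: "(complex \<Rightarrow> complex) set" where
  "class_A = {f. f holomorphic_on unit_disk \<and> f 0 = 0 \<and> deriv f 0 = 1}"

definition subordinate :: "(complex \<Rightarrow> complex) \<Rightarrow> (complex \<Rightarrow> complex) \<Rightarrow> bool" where
  "subordinate g h \<longleftrightarrow>
     (\<exists>\<omega>. \<omega> holomorphic_on unit_disk \<and> \<omega> ` unit_disk \<subseteq> unit_disk \<and> \<omega> 0 = 0 \<and>
          (\<forall>z\<in>unit_disk. g z = h (\<omega> z)))"

(* z f'(z) / f(z), with the removable singularity at 0 filled in (HOL's x / 0 would give 0 there). *)
definition log_deriv_quot :: "(complex \<Rightarrow> complex) \<Rightarrow> complex \<Rightarrow> complex" where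
  "log_deriv_quot f z = (if z = 0 then 1 else z * deriv f z / f z)"

(* The functions phi of interest are holomorphic on the unit disk with phi 0 = 1.
   The absence of further zeros of f is explicit, since division is total in HOL. *)
definition S_star :: "(complex \<Rightarrow> complex) \<Rightarrow> (complex \<Rightarrow> complex) set" where
  "S_star \<phi> = {f \<in> class_A. (\<forall>z\<in>unit_disk - {0}. f z \<noteq> 0) \<and> subordinate (log_deriv_quot f) \<phi>}"

definition dilate :: "real \<Rightarrow> (complex \<Rightarrow> complex) \<Rightarrow> complex \<Rightarrow> complex" where
  "dilate r f z = f (of_real r * z) / of_real r"

(* S_star_radius phi2 phi1 is the sharp S*(phi2)-radius of the class S*(phi1). *)
definition S_star_radius :: "(complex \<Rightarrow> complex) \<Rightarrow> (complex \<Rightarrow> complex) \<Rightarrow> real" where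
  "S_star_radius \<phi>2 \<phi>1 =
     Sup {r. 0 < r \<and> r \<le> 1 \<and> (\<forall>f\<in>S_star \<phi>1. dilate r f \<in> S_star \<phi>2)}"

(* The entire function cosh (sqrt z); see phi_H_eq_cosh. *)
definition phi_H :: "complex \<Rightarrow> complex" where
  "phi_H z = (\<Sum>n. z ^ n / fact (2 * n))"

definition phi_L :: "complex \<Rightarrow> complex" where
  "phi_L z = csqrt (1 + z)"

lemma phi_H_sums: "(\<lambda>n. z ^ n / fact (2 * n)) sums cosh (csqrt z)"
proof -
  have "(\<lambda>n. if even n then csqrt z ^ n /\<^sub>R fact n else 0) sums cosh (csqrt z)"
    by (rule cosh_converges)
  then have "(\<lambda>n. (\<lambda>n. if even n then csqrt z ^ n /\<^sub>R fact n else 0) (2 * n)) sums cosh (csqrt z)"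
    by (subst sums_mono_reindex) (auto simp: strict_mono_def elim!: evenE)
  then show ?thesis
    by (simp add: power_mult scaleR_conv_of_real divide_inverse mult.commute[of "inverse (fact _)"])
qed

lemma phi_H_eq_cosh: "phi_H z = cosh (csqrt z)"
  unfolding phi_H_def using phi_H_sums by (rule sums_unique[symmetric])

lemma phi_H_0: "phi_H 0 = 1"
  by (simp add: phi_H_eq_cosh)

lemma phi_L_0: "phi_L 0 = 1"
  by (simp add: phi_L_def)

end

theory Submission
  imports Defs "HOL-Complex_Analysis.Complex_Analysis"
begin

text \<open>
  On the whole plane \<open>phi_H z ^ 2 - 1 = (phi_H (4 * z) - 1) / 2 = sinh\<^sup>2 (sqrt z)\<close>, a power
  series with nonnegative coefficients, so its modulus on \<open>|z| \<le> s\<close> is at most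
  \<open>sinh\<^sup>2 (sqrt s)\<close>, with equality at \<open>z = s\<close>. This bound is \<open>1\<close> exactly for
  \<open>s = (arsinh 1)\<^sup>2\<close>. Up to this radius, \<open>phi_H (w)\<^sup>2 - 1\<close> with \<open>w\<close> the Schwarz function of \<open>f\<close> is
  itself a Schwarz function, which exhibits the subordination to \<open>phi_L\<close>; beyond it, the function \<open>f\<close>
  with \<open>z f' / f = phi_H\<close> violates the subordination at the point of the positive axis where
  \<open>phi_H\<^sup>2 - 1 = 1\<close>.
\<close>

section \<open>The entire function \<open>phi_H\<close> and its bounds on disks\<close>

lemma phi_H_square: "phi_H (s\<^sup>2) = cosh s"
proof -
  \<comment> \<open>\<open>csqrt\<close> may return either root; evenness of \<open>cosh\<close>
    makes the choice irrelevant.\<close>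
  have "csqrt (s\<^sup>2) = s \<or> csqrt (s\<^sup>2) = - s"
    unfolding power2_eq_iff[symmetric] by simp
  then show ?thesis
    unfolding phi_H_eq_cosh by (metis cosh_minus)
qed

lemma phi_H_of_real: "x \<ge> 0 \<Longrightarrow> phi_H (of_real x) = of_real (cosh (sqrt x))"
  using phi_H_square[of "of_real (sqrt x)"]
  by (simp add: cosh_field_def exp_of_real flip: of_real_power of_real_minus)

lemma phi_H_power2: "(phi_H z)\<^sup>2 - 1 = (phi_H (4 * z) - 1) / 2"
proof -
  have "phi_H (4 * z) = cosh (2 * csqrt z)"
    using phi_H_square[of "2 * csqrt z"] by (simp add: power_mult_distrib)
  then show ?thesis
    unfolding cosh_double_cosh phi_H_eq_cosh[of z] by simp
qed

text \<open>The power series converges on the whole plane. The form \<open>cosh (csqrt z)\<close>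
  would not give this directly, as \<open>csqrt\<close> jumps across the negative axis.\<close>

lemma phi_H_holomorphic: "phi_H holomorphic_on S"
proof -
  have "((\<lambda>z. \<Sum>n. (1 / fact (2 * n)) * z ^ n) has_field_derivative
          (\<Sum>n. diffs (\<lambda>n. 1 / fact (2 * n)) n * z ^ n)) (at z)" for z :: complex
    by (rule termdiffs_strong_converges_everywhere)
       (use phi_H_sums in \<open>simp add: sums_iff\<close>)
  then have "phi_H field_differentiable (at z)" for z
    unfolding phi_H_def field_differentiable_def by auto
  then show ?thesis
    by (simp add: field_differentiable_at_within holomorphic_on_def)
qed

text \<open>Termwise triangle inequality: the coefficients are positive, so the majorant is the same
  series at the real point \<open>norm z\<close>. Removing the constant term 1 makes the bound small
  near 0.\<close>

lemma norm_phi_H_minus_1_le: "norm (phi_H z - 1) \<le> cosh (sqrt (norm z)) - 1"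
proof -
  have tail: "(\<lambda>n. z ^ Suc n / fact (2 * Suc n)) sums (phi_H z - 1)" for z
    using sums_Suc_iff[of "\<lambda>n. z ^ n / fact (2 * n)" "phi_H z - 1"] phi_H_sums[of z]
    by (simp add: phi_H_eq_cosh)
  have "(\<lambda>n. complex_of_real (norm z ^ Suc n / fact (2 * Suc n)))
          sums of_real (cosh (sqrt (norm z)) - 1)"
    using tail[of "of_real (norm z)"] by (simp add: phi_H_of_real)
  then have maj: "(\<lambda>n. norm z ^ Suc n / fact (2 * Suc n)) sums (cosh (sqrt (norm z)) - 1)"
    by (simp only: sums_of_real_iff)
  have eq: "norm (z ^ Suc n / fact (2 * Suc n)) = norm z ^ Suc n / fact (2 * Suc n)" for n
    by (simp only: norm_divide norm_power norm_fact)
  have "summable (\<lambda>n. norm (z ^ Suc n / fact (2 * Suc n)))"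
    unfolding eq using maj by (rule sums_summable)
  from summable_norm[OF this] show ?thesis
    unfolding eq using tail[of z] maj by (simp only: sums_iff)
qed

text \<open>The previous bound at \<open>4 * z\<close>, where the square root doubles, combined with
  cosh(2s) - 1 = 2 sinh(s)^2.\<close>

lemma norm_phi_H_power2_minus_1_le: "norm ((phi_H z)\<^sup>2 - 1) \<le> (sinh (sqrt (norm z)))\<^sup>2"
proof -
  have "norm ((phi_H z)\<^sup>2 - 1) \<le> (cosh (2 * sqrt (norm z)) - 1) / 2"
    using norm_phi_H_minus_1_le[of "4 * z"]
    by (simp add: phi_H_power2 norm_divide norm_mult real_sqrt_mult)
  then show ?thesis
    by (simp add: cosh_double cosh_square_eq)
qed

section \<open>The critical radius and the branch of the square root\<close>

lemma arsinh_1_nonneg: "0 \<le> arsinh (1::real)"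
  by (intro less_imp_le) simp

lemma arsinh_1_le_1: "arsinh (1::real) \<le> 1"
proof -
  \<comment> \<open>5/2 = 1 + 1 + 1/2 is the quadratic Taylor bound for e; it gives sinh 1 \<ge>
    (5/2 - 2/5)/2 > 1.\<close>
  have e: "(5/2 :: real) \<le> exp 1"
    using exp_lower_Taylor_quadratic[of "1::real"] by simp
  then have "exp (-1) \<le> (2/5 :: real)"
    by (simp add: exp_minus field_simps)
  with e have "sinh (arsinh 1) \<le> sinh (1::real)"
    unfolding sinh_arsinh_real by (simp add: sinh_field_def)
  then show ?thesis
    by (simp only: sinh_real_le_iff)
qed

lemma arsinh_1_power2_le_1: "(arsinh (1::real))\<^sup>2 \<le> 1"
  using arsinh_1_nonneg arsinh_1_le_1 by (intro power_le_one) auto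

lemma norm_phi_H_power2_minus_1_less:
  assumes "norm z < (arsinh 1)\<^sup>2"
  shows "norm ((phi_H z)\<^sup>2 - 1) < 1"
proof -
  have "sqrt (norm z) < arsinh 1"
    using assms arsinh_1_nonneg by (intro real_less_lsqrt) auto
  then have "sinh (sqrt (norm z)) < 1"
    by (metis sinh_arsinh_real sinh_real_less_iff)
  then have "(sinh (sqrt (norm z)))\<^sup>2 < 1"
    by (simp add: abs_square_less_1)
  then show ?thesis
    using norm_phi_H_power2_minus_1_le[of z] by linarith
qed

text \<open>Fixes the branch: in the right half-plane the principal root of the square of
  \<open>phi_H z\<close> is \<open>phi_H z\<close> and not its negative. Here \<open>phi_H z\<close>
  stays within sqrt 2 - 1 < 1 of 1.\<close>

lemma Re_phi_H_pos:
  assumes "norm z < (arsinh 1)\<^sup>2"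
  shows "Re (phi_H z) > 0"
proof -
  have "sqrt (norm z) < arsinh 1"
    using assms arsinh_1_nonneg by (intro real_less_lsqrt) auto
  then have "cosh (sqrt (norm z)) < cosh (arsinh 1)"
    using arsinh_1_nonneg by (subst cosh_real_nonneg_less_iff) auto
  also have "\<dots> = sqrt 2"
    by (simp add: cosh_arsinh_real)
  also have "\<dots> < 2"
    by (simp add: real_less_lsqrt)
  finally have "norm (1 - phi_H z) < 1"
    using norm_phi_H_minus_1_le[of z] by (simp add: norm_minus_commute)
  then show ?thesis
    using complex_Re_le_cmod[of "1 - phi_H z"] by simp
qed

lemma phi_L_power2_minus_1: "Re u > 0 \<Longrightarrow> phi_L (u\<^sup>2 - 1) = u"
  by (simp add: phi_L_def csqrt_square)

lemma power2_phi_L: "(phi_L v)\<^sup>2 = 1 + v"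
  by (simp add: phi_L_def)

section \<open>Dilations\<close>

lemma mult_of_real_in_unit_disk:
  "0 < r \<Longrightarrow> r \<le> 1 \<Longrightarrow> z \<in> unit_disk \<Longrightarrow> complex_of_real r * z \<in> unit_disk"
  using mult_left_le_one_le[of "norm z" r] by (simp add: norm_mult)

lemma deriv_dilate:
  assumes "f holomorphic_on unit_disk" "0 < r" "r \<le> 1" "z \<in> unit_disk"
  shows "deriv (dilate r f) z = deriv f (of_real r * z)"
proof -
  have "of_real r * z \<in> unit_disk"
    using assms by (intro mult_of_real_in_unit_disk)
  then have "(f has_field_derivative deriv f (of_real r * z)) (at (of_real r * z))"
    using assms by (auto intro!: holomorphic_derivI)
  \<comment> \<open>The factor r from the chain rule cancels the normalising 1/r.\<close>
  then have "(dilate r f has_field_derivative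
      (deriv f (of_real r * z) * of_real r) / of_real r) (at z)"
    unfolding dilate_def by (auto intro!: derivative_eq_intros DERIV_chain2)
  then show ?thesis
    using assms by (auto intro: DERIV_imp_deriv)
qed

lemma log_deriv_quot_dilate:
  assumes "f holomorphic_on unit_disk" "0 < r" "r \<le> 1" "z \<in> unit_disk"
  shows "log_deriv_quot (dilate r f) z = log_deriv_quot f (of_real r * z)"
  using assms by (simp add: log_deriv_quot_def deriv_dilate dilate_def)

lemma dilate_in_class_A:
  assumes "f \<in> class_A" "0 < r" "r \<le> 1"
  shows "dilate r f \<in> class_A"
proof -
  have hol: "f holomorphic_on unit_disk" and "f 0 = 0" "deriv f 0 = 1"
    using assms by (auto simp: class_A_def)
  have "(f \<circ> (\<lambda>z. of_real r * z)) holomorphic_on unit_disk"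
    using assms mult_of_real_in_unit_disk
    by (intro holomorphic_on_compose_gen[OF _ hol] holomorphic_intros) auto
  then have "dilate r f holomorphic_on unit_disk"
    using assms unfolding dilate_def o_def by (intro holomorphic_intros) auto
  moreover have "deriv (dilate r f) 0 = 1"
    using deriv_dilate[OF hol, of r 0] assms \<open>deriv f 0 = 1\<close> by simp
  ultimately show ?thesis
    using \<open>f 0 = 0\<close> by (simp add: class_A_def dilate_def)
qed

section \<open>Functions with a prescribed quotient z f'/f\<close>

lemma S_star_extremal:
  assumes hol: "\<phi> holomorphic_on unit_disk" and "\<phi> 0 = 1"
  obtains f where "f \<in> S_star \<phi>" "\<And>z. z \<in> unit_disk \<Longrightarrow> log_deriv_quot f z = \<phi> z"
proof -
  \<comment> \<open>The equation z f'/f = \<phi> reads (log(f/z))' = (\<phi> - 1)/z. Its right side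
    is \<open>h\<close>, with the removable singularity filled in.\<close>
  define h where "h z = (if z = 0 then deriv \<phi> 0 else (\<phi> z - \<phi> 0) / (z - 0))" for z
  have "h holomorphic_on unit_disk"
    unfolding h_def by (rule pole_lemma[OF hol]) auto
  then obtain g where g: "\<And>z. z \<in> unit_disk \<Longrightarrow> (g has_field_derivative h z) (at z)"
    using holomorphic_convex_primitive'[OF convex_ball open_ball \<open>h holomorphic_on unit_disk\<close>]
    by (metis at_within_open open_ball)
  \<comment> \<open>Subtracting \<open>g 0\<close> makes the exponential 1 at the origin, hence
    f'(0) = 1.\<close>
  define f where "f z = z * exp (g z - g 0)" for z
  have f': "(f has_field_derivative \<phi> z * exp (g z - g 0)) (at z)" if "z \<in> unit_disk" for z
  proof -
    have "(f has_field_derivative exp (g z - g 0) + z * (exp (g z - g 0) * h z)) (at z)"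
      unfolding f_def using g[OF that] by (auto intro!: derivative_eq_intros)
    moreover have "z * h z = \<phi> z - 1"
      by (simp add: h_def \<open>\<phi> 0 = 1\<close>)
    then have "exp (g z - g 0) + z * (exp (g z - g 0) * h z) = \<phi> z * exp (g z - g 0)"
      by algebra
    ultimately show ?thesis
      by simp
  qed
  have "f holomorphic_on unit_disk"
    using f' by (subst holomorphic_on_open) blast+
  moreover have deriv_f: "deriv f z = \<phi> z * exp (g z - g 0)" if "z \<in> unit_disk" for z
    using f'[OF that] by (rule DERIV_imp_deriv)
  ultimately have "f \<in> class_A"
    using \<open>\<phi> 0 = 1\<close> by (simp add: class_A_def f_def)
  have quot: "log_deriv_quot f z = \<phi> z" if "z \<in> unit_disk" for z
    using deriv_f[OF that] \<open>\<phi> 0 = 1\<close> by (simp add: log_deriv_quot_def f_def)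
  then have "subordinate (log_deriv_quot f) \<phi>"
    unfolding subordinate_def by (intro exI[of _ "\<lambda>z. z"]) auto
  with \<open>f \<in> class_A\<close> quot show thesis
    by (intro that[of f]) (auto simp: S_star_def f_def)
qed

section \<open>The radius: inclusion and sharpness\<close>

lemma dilate_in_S_star_phi_L:
  assumes f: "f \<in> S_star phi_H" and "0 < r" "r \<le> (arsinh 1)\<^sup>2"
  shows "dilate r f \<in> S_star phi_L"
proof -
  have "r \<le> 1"
    using assms arsinh_1_power2_le_1 by linarith
  have fA: "f \<in> class_A" and nz: "\<forall>z\<in>unit_disk - {0}. f z \<noteq> 0"
    using f by (auto simp: S_star_def)
  then have hol: "f holomorphic_on unit_disk"
    by (simp add: class_A_def)
  obtain \<omega> where \<omega>: "\<omega> holomorphic_on unit_disk" "\<omega> ` unit_disk \<subseteq> unit_disk" "\<omega> 0 = 0"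
    and quot: "\<forall>z\<in>unit_disk. log_deriv_quot f z = phi_H (\<omega> z)"
    using f by (auto simp: S_star_def subordinate_def)
  define w where "w z = \<omega> (of_real r * z)" for z
  have in_disk: "of_real r * z \<in> unit_disk" if "z \<in> unit_disk" for z
    using mult_of_real_in_unit_disk assms \<open>r \<le> 1\<close> that by blast
  have w_less: "norm (w z) < (arsinh 1)\<^sup>2" if "z \<in> unit_disk" for z
  proof -
    \<comment> \<open>The Schwarz lemma turns the dilation by \<open>r\<close> into a bound on the
      argument of \<open>phi_H\<close>.\<close>
    have "norm (w z) \<le> norm (of_real r * z)"
      unfolding w_def
      using \<omega>(1,3) image_subset_iff[THEN iffD1, OF \<omega>(2)] in_disk[OF that]
      by (intro Schwarz_Lemma(1)[of \<omega>]) auto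
    also have "\<dots> < r"
      using that \<open>0 < r\<close> by (simp add: norm_mult)
    finally show ?thesis
      using assms by simp
  qed
  have w_hol: "w holomorphic_on unit_disk"
    unfolding w_def using in_disk
    by (intro holomorphic_on_compose_gen[OF _ \<omega>(1), unfolded o_def] holomorphic_intros) auto
  have "(\<lambda>z. phi_H (w z)) holomorphic_on unit_disk"
    by (rule holomorphic_on_compose[OF w_hol phi_H_holomorphic, unfolded o_def])
  then have "(\<lambda>z. (phi_H (w z))\<^sup>2 - 1) holomorphic_on unit_disk"
    by (intro holomorphic_intros)
  moreover have "log_deriv_quot (dilate r f) z = phi_L ((phi_H (w z))\<^sup>2 - 1)"
    if "z \<in> unit_disk" for z
    using that quot in_disk[OF that] Re_phi_H_pos[OF w_less[OF that]] \<open>0 < r\<close> \<open>r \<le> 1\<close>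
    by (simp add: log_deriv_quot_dilate[OF hol] phi_L_power2_minus_1 w_def)
  moreover have "w 0 = 0"
    by (simp add: w_def \<omega>)
  ultimately have "subordinate (log_deriv_quot (dilate r f)) phi_L"
    unfolding subordinate_def using norm_phi_H_power2_minus_1_less[OF w_less]
    by (intro exI[of _ "\<lambda>z. (phi_H (w z))\<^sup>2 - 1"]) (auto simp: phi_H_0)
  moreover have "\<forall>z\<in>unit_disk - {0}. dilate r f z \<noteq> 0"
    using nz in_disk \<open>0 < r\<close> by (simp add: dilate_def)
  ultimately show ?thesis
    using dilate_in_class_A[OF fA \<open>0 < r\<close> \<open>r \<le> 1\<close>] by (simp add: S_star_def)
qed

lemma radius_le_if_dilate_in_S_star_phi_L:
  assumes "0 < r" "r \<le> 1" and all: "\<forall>f\<in>S_star phi_H. dilate r f \<in> S_star phi_L"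
  shows "r \<le> (arsinh 1)\<^sup>2"
proof (rule ccontr)
  define R :: real where "R = (arsinh 1)\<^sup>2"
  assume "\<not> r \<le> (arsinh 1)\<^sup>2"
  then have "R < r"
    by (simp add: R_def)
  have "0 \<le> R"
    by (simp add: R_def)
  obtain f where f: "f \<in> S_star phi_H"
    and quot: "\<And>z. z \<in> unit_disk \<Longrightarrow> log_deriv_quot f z = phi_H z"
    using S_star_extremal[OF phi_H_holomorphic phi_H_0] by blast
  \<comment> \<open>The dilation by \<open>r\<close> carries this point to \<open>R\<close>, where
    \<open>phi_H\<close> equals sqrt 2; it lies in the disk because \<open>R < r\<close>.\<close>
  define z where "z = complex_of_real (R / r)"
  have z: "z \<in> unit_disk" and rz: "of_real r * z = of_real R"
    using \<open>R < r\<close> \<open>0 \<le> R\<close> \<open>0 < r\<close> by (auto simp: z_def norm_divide)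
  have "complex_of_real R \<in> unit_disk"
    using \<open>R < r\<close> \<open>0 \<le> R\<close> \<open>r \<le> 1\<close> by simp
  moreover have "f holomorphic_on unit_disk"
    using f by (simp add: S_star_def class_A_def)
  ultimately have "log_deriv_quot (dilate r f) z = phi_H (of_real R)"
    using log_deriv_quot_dilate[OF _ \<open>0 < r\<close> \<open>r \<le> 1\<close> z] rz quot by simp
  also have "\<dots> = of_real (sqrt 2)"
    using arsinh_1_nonneg
    by (subst phi_H_of_real[OF \<open>0 \<le> R\<close>]) (simp add: R_def cosh_arsinh_real)
  finally have *: "log_deriv_quot (dilate r f) z = of_real (sqrt 2)" .
  obtain v where "v \<in> unit_disk" "log_deriv_quot (dilate r f) z = phi_L v"
  proof -
    have "subordinate (log_deriv_quot (dilate r f)) phi_L"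
      using all f by (simp add: S_star_def)
    then show thesis
      using z that unfolding subordinate_def by blast
  qed
  \<comment> \<open>Squaring removes the branch and forces \<open>v = 1\<close>, a boundary point
    outside the open disk.\<close>
  then have "1 + v = (of_real (sqrt 2))\<^sup>2"
    using power2_phi_L[of v] * by simp
  then have "v = 1"
    by (simp flip: of_real_power)
  with \<open>v \<in> unit_disk\<close> show False
    by simp
qed

theorem theorem7p2:
  shows "S_star_radius phi_L phi_H = (arcosh (sqrt 2))\<^sup>2 \<and>
         (arcosh (sqrt 2))\<^sup>2 = (arsinh (1::real))\<^sup>2"
proof -
  have "arcosh (cosh (arsinh (1::real))) = arsinh 1"
    using arsinh_1_nonneg by (rule arcosh_cosh_real)
  then have eq: "arcosh (sqrt 2) = arsinh (1::real)"
    by (simp add: cosh_arsinh_real)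
  have "S_star_radius phi_L phi_H = (arsinh 1)\<^sup>2"
    unfolding S_star_radius_def
  \<comment> \<open>The supremum is attained, since the inclusion includes the endpoint.\<close>
  proof (rule cSup_eq_maximum)
    show "(arsinh 1)\<^sup>2 \<in> {r. 0 < r \<and> r \<le> 1 \<and> (\<forall>f\<in>S_star phi_H. dilate r f \<in> S_star phi_L)}"
      using arsinh_1_power2_le_1 by (simp add: dilate_in_S_star_phi_L)
  qed (blast intro: radius_le_if_dilate_in_S_star_phi_L)
  with eq show ?thesis
    by (simp only: simp_thms)
qed

end
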